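(* Let $\Omega\subseteq\mathbb{R}^2$ be an open, bounded, simply connected polygonal region and let $\mathcal{T}$ be a triangulation of $\Omega$. Then $\mathcal{T}$ is bipartite if and only if for every interior vertex $\xi$ of $\mathcal{T}$ the number of incident triangles $\#\{K\in\mathcal{T}:\xi\in\partial K\}$ is even.
   Context: A triangulation $\mathcal{T}$ of a bounded open polygonal domain $\mathcal{O}\subseteq\mathbb{R}^2$ (as usual, a domain equal to the interior of its closure, so no slits) is a finite conforming family of closed non-degenerate triangles: their union is the closure of $\mathcal{O}$, and any two distinct triangles meet in the empty set, a common vertex, or a common side. The associated graph $\mathcal{G}_{\mathcal{T}}$ has the triangles of $\mathcal{T}$ as vertices, with an arc between distinct $K,L\in\mathcal{T}$ if $|\partial K\cap\partial L|>0$ (length), i.e. if they share a common side. The triangulation is called bipartite if $\mathcal{G}_{\mathcal{T}}$ is a bipartite graph, i.e. the set of triangles can be partitioned into two subsets such that every arc has one endpoint in each. A vertex of the triangulation (a vertex of one of its triangles) is exterior if it lies on $\partial\mathcal{O}$ and interior if it lies in the interior of the domain. *)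

theory Defs
  imports "HOL-Analysis.Analysis"
begin

definition polygonal_domain :: "(real^2) set \<Rightarrow> bool" where
  "polygonal_domain \<Omega> \<longleftrightarrow>
     open \<Omega> \<and> bounded \<Omega> \<and> interior (closure \<Omega>) = \<Omega> \<and>
     (\<exists>S. finite S \<and> frontier \<Omega> = (\<Union>(a, b)\<in>S. closed_segment a b))"

(* The library's triangulation predicate says that the family is finite, consists of simplices,
   and that any two members meet in a common face of both. For distinct non-degenerate triangles
   in the plane that face is proper, i.e. empty, a common vertex or a common side. *)
definition triangulation_of :: "(real^2) set set \<Rightarrow> (real^2) set \<Rightarrow> bool" where
  "triangulation_of \<T> \<Omega> \<longleftrightarrow>
     triangulation \<T> \<and> (\<forall>K\<in>\<T>. 2 simplex K) \<and> \<Union>\<T> = closure \<Omega>"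

(* Arc relation of the associated graph on the vertex set \<T> (the positive length of the common
   boundary is expressed as a shared side). *)
definition triangle_arcs :: "(real^2) set set \<Rightarrow> ((real^2) set \<times> (real^2) set) set" where
  "triangle_arcs \<T> =
     {(K, L). K \<in> \<T> \<and> L \<in> \<T> \<and> K \<noteq> L \<and> (\<exists>e. e edge_of K \<and> e edge_of L)}"

(* The two classes may be empty. *)
definition bipartite_graph :: "'a set \<Rightarrow> ('a \<times> 'a) set \<Rightarrow> bool" where
  "bipartite_graph V E \<longleftrightarrow>
     (\<exists>A B. A \<union> B = V \<and> A \<inter> B = {} \<and>
        (\<forall>(u, v)\<in>E. u \<in> A \<and> v \<in> B \<or> u \<in> B \<and> v \<in> A))"

definition bipartite_triangulation :: "(real^2) set set \<Rightarrow> bool" where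
  "bipartite_triangulation \<T> \<longleftrightarrow> bipartite_graph \<T> (triangle_arcs \<T>)"

definition triangulation_vertices :: "(real^2) set set \<Rightarrow> (real^2) set" where
  "triangulation_vertices \<T> = {\<xi>. \<exists>K\<in>\<T>. \<xi> extreme_point_of K}"

definition interior_vertices :: "(real^2) set set \<Rightarrow> (real^2) set \<Rightarrow> (real^2) set" where
  "interior_vertices \<T> \<Omega> = triangulation_vertices \<T> \<inter> interior \<Omega>"

end

theory Submission
  imports Defs
begin

text \<open>
  If the triangulation is bipartite, double counting the pairs (triangle, edge) at an interior
  vertex shows that each class contributes half as many triangles there as there are edges, so
  that both contribute the same number.

  Conversely, identify the plane with the complex numbers. For an edge with ends \<open>u\<close>, \<open>v\<close>
  the square root of \<open>(z - u)(z - v)\<close> cut along the edge changes sign across it. The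
  square of the product of these roots over all edges is the product over all vertices of
  \<open>(z - \<xi>)\<close> raised to the number of edges at \<open>\<xi>\<close>. This has a continuous square root \<open>G\<close> on the
  domain: the exponent is even if \<open>\<xi>\<close> lies in the domain, and otherwise \<open>z - \<xi>\<close> has no zero
  in the domain, which is simply connected. Dividing the product of the edge roots by \<open>G\<close>
  gives a function that is constantly 1 or constantly -1 on every open triangle and flips its sign
  across every shared edge: a proper 2-colouring.
\<close>

subsection \<open>Planar geometry of a triangle\<close>

text \<open>The determinant with columns \<open>x\<close> and \<open>y\<close>. The sign of
  \<open>cross2 (v - u) (y - u)\<close> tells on which side of the line through \<open>u\<close> and
  \<open>v\<close> the point \<open>y\<close> lies.\<close>

definition cross2 :: "real^2 \<Rightarrow> real^2 \<Rightarrow> real" where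
  "cross2 x y = x$1 * y$2 - x$2 * y$1"

text \<open>The quarter turn counterclockwise, which is multiplication by the imaginary unit in the
  complex plane. It supplies the normal direction of an edge.\<close>

definition perp :: "real^2 \<Rightarrow> real^2" where
  "perp d = vector [- d$2, d$1]"

lemma perp_nth [simp]: "perp d $ 1 = - d$2" "perp d $ 2 = d$1"
  by (simp_all add: perp_def)

lemma cross2_perp_pos: "d \<noteq> 0 \<Longrightarrow> cross2 d (perp d) > 0"
  by (simp add: cross2_def vec_eq_iff forall_2 sum_power2_gt_zero_iff flip: power2_eq_square)

lemma cross2_simps [simp]:
  "cross2 x 0 = 0" "cross2 0 y = 0" "cross2 x x = 0"
  by (simp_all add: cross2_def)

lemma cross2_add_right: "cross2 x (y + z) = cross2 x y + cross2 x z"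
  by (simp add: cross2_def algebra_simps)

lemma cross2_scaleR_right: "cross2 x (c *\<^sub>R y) = c * cross2 x y"
  by (simp add: cross2_def algebra_simps)

text \<open>Cramer's rule. It yields the barycentric coordinates of a point with respect to a
  triangle.\<close>

lemma cramer2:
  assumes "cross2 a b \<noteq> 0"
  shows "y = (cross2 y b / cross2 a b) *\<^sub>R a + (cross2 a y / cross2 a b) *\<^sub>R b"
proof -
  have "cross2 y b * a $ i + cross2 a y * b $ i = cross2 a b * y $ i" for i
    using exhaust_2[of i] by (auto simp: cross2_def algebra_simps)
  then show ?thesis
    using assms by (simp add: vec_eq_iff field_simps)
qed

lemma cross2_eq_0_imp_scaleR:
  assumes "cross2 a b = 0" "a \<noteq> 0"
  obtains c where "b = c *\<^sub>R a"
proof -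
  have "(a$1 \<noteq> 0 \<or> a$2 \<noteq> 0)"
    using assms(2) by (auto simp: vec_eq_iff forall_2)
  then show ?thesis
  proof
    assume "a$1 \<noteq> 0"
    then have "b = (b$1 / a$1) *\<^sub>R a"
      using assms(1) by (simp add: vec_eq_iff forall_2 cross2_def field_simps)
    then show ?thesis by (rule that)
  next
    assume "a$2 \<noteq> 0"
    then have "b = (b$2 / a$2) *\<^sub>R a"
      using assms(1) by (simp add: vec_eq_iff forall_2 cross2_def field_simps)
    then show ?thesis by (rule that)
  qed
qed

lemma affine_independent_cross2_nonzero:
  assumes "\<not> affine_dependent {u, v, w}" "u \<noteq> v" "u \<noteq> w" "v \<noteq> w"
  shows "cross2 (v - u) (w - u) \<noteq> 0"
proof
  assume "cross2 (v - u) (w - u) = 0"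
  then obtain c where c: "w - u = c *\<^sub>R (v - u)"
    using cross2_eq_0_imp_scaleR[of "v - u" "w - u"] assms(2) by auto
  have "collinear {u, v, w}"
    unfolding collinear_alt
    by (rule exI[of _ u], rule exI[of _ "v - u"])
      (use c in \<open>auto intro: exI[of _ 0] exI[of _ 1] exI[of _ c] simp: algebra_simps\<close>)
  then show False
    using assms collinear_3_eq_affine_dependent[of u v w] by auto
qed

lemma triangleE:
  assumes "2 simplex K"
  obtains u v w where "\<not> affine_dependent {u, v, w}" "u \<noteq> v" "u \<noteq> w" "v \<noteq> w"
    "K = convex hull {u, v, w}"
proof -
  obtain C where C: "\<not> affine_dependent C" "int (card C) = 3" "K = convex hull C"
    using assms by (auto simp: simplex_def)
  then have "card C = 3"
    by simp
  then obtain u v w where "C = {u, v, w}" "u \<noteq> v" "u \<noteq> w" "v \<noteq> w"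
    by (auto simp: card_3_iff)
  with C that show ?thesis
    by blast
qed

text \<open>The faces of a simplex are the hulls of subsets of its corners, and dimension 1 forces
  such a subset to have two elements.\<close>

lemma edge_of_convex_hull_iff:
  assumes "\<not> affine_dependent C"
  shows "e edge_of convex hull C \<longleftrightarrow> (\<exists>a\<in>C. \<exists>b\<in>C. a \<noteq> b \<and> e = closed_segment a b)"
proof
  assume "e edge_of convex hull C"
  then obtain c where c: "c \<subseteq> C" "e = convex hull c" and dim: "aff_dim e = 1"
    using face_of_convex_hull_affine_independent[OF assms] by (auto simp: edge_of_def)
  then have "int (card c) = 2"
    using aff_dim_affine_independent[OF affine_independent_subset[OF assms c(1)]]
    by (simp add: aff_dim_convex_hull)
  then have "card c = 2"
    by simp
  then obtain a b where "c = {a, b}" "a \<noteq> b"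
    by (auto simp: card_2_iff)
  with c show "\<exists>a\<in>C. \<exists>b\<in>C. a \<noteq> b \<and> e = closed_segment a b"
    by (auto simp: segment_convex_hull)
next
  assume "\<exists>a\<in>C. \<exists>b\<in>C. a \<noteq> b \<and> e = closed_segment a b"
  then obtain a b where ab: "a \<in> C" "b \<in> C" "a \<noteq> b" "e = convex hull {a, b}"
    by (auto simp: segment_convex_hull)
  then have "{a, b} \<subseteq> C" "aff_dim e = 1"
    by (auto simp: aff_dim_convex_hull)
  then show "e edge_of convex hull C"
    using face_of_convex_hull_affine_independent[OF assms, of e] ab(4)
    unfolding edge_of_def by blast
qed

text \<open>A normal form with the given ends of the edge listed first. The sign of the determinant
  at \<open>w\<close> then records the side on which the triangle lies.\<close>

lemma edge_of_triangleE:
  assumes "2 simplex K" "closed_segment u v edge_of K"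
  obtains w where "K = convex hull {u, v, w}" "cross2 (v - u) (w - u) \<noteq> 0" "u \<noteq> v"
proof -
  obtain a b c where K: "\<not> affine_dependent {a, b, c}" "a \<noteq> b" "a \<noteq> c" "b \<noteq> c"
    "K = convex hull {a, b, c}"
    using triangleE[OF assms(1)] .
  then obtain p q where pq: "p \<in> {a, b, c}" "q \<in> {a, b, c}" "p \<noteq> q"
      "closed_segment u v = closed_segment p q"
    using edge_of_convex_hull_iff[of "{a, b, c}"] assms(2) by blast
  have uv: "{u, v} = {p, q}"
    using pq(4) by simp
  obtain w where w: "w \<in> {a, b, c}" "w \<noteq> u" "w \<noteq> v" "{u, v, w} = {a, b, c}" "u \<noteq> v"
    using uv pq(1,2,3) K(2,3,4) by (auto simp: doubleton_eq_iff)
  show ?thesis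
    using that[of w] affine_independent_cross2_nonzero[of u v w] w K by auto
qed

lemma edge_ofE:
  assumes "2 simplex K" "e edge_of K"
  obtains u v where "e = closed_segment u v" "u \<noteq> v"
proof -
  obtain a b c where "\<not> affine_dependent {a, b, c}" "K = convex hull {a, b, c}"
    using triangleE[OF assms(1)] .
  then show ?thesis
    using that edge_of_convex_hull_iff[of "{a, b, c}" e] assms(2) by blast
qed

lemma cross2_closed_segment:
  assumes "x \<in> closed_segment u v"
  shows "cross2 (v - u) (x - u) = 0"
proof -
  obtain s where "x - u = s *\<^sub>R (v - u)"
    using assms by (auto simp: in_segment algebra_simps)
  then show ?thesis
    by (simp add: cross2_scaleR_right)
qed

text \<open>The determinant at \<open>y\<close> is that at \<open>w\<close> times the barycentric
  coordinate of \<open>w\<close>. Comparing sides by a product avoids fixing an orientation.\<close>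

lemma triangle_side:
  assumes "y \<in> convex hull {u, v, w}"
  shows "0 \<le> cross2 (v - u) (y - u) * cross2 (v - u) (w - u)"
proof -
  obtain a b c where abc: "0 \<le> c" "a + b + c = 1" "y = a *\<^sub>R u + b *\<^sub>R v + c *\<^sub>R w"
    using assms by (auto simp: convex_hull_3)
  have "y - u = b *\<^sub>R (v - u) + c *\<^sub>R (w - u)"
    using abc(2) unfolding abc(3) by (simp add: algebra_simps flip: scaleR_add_left)
  then have "cross2 (v - u) (y - u) = c * cross2 (v - u) (w - u)"
    by (simp add: cross2_add_right cross2_scaleR_right)
  then show ?thesis
    using abc(1) by (simp add: mult.assoc)
qed

text \<open>Let \<mu> and \<nu> be the barycentric coordinates belonging to \<open>v\<close> and
  \<open>w\<close>. At \<open>x\<close> they are \<open>s\<close> with \<open>0 < s < 1\<close> and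
  0, so \<mu> > 0 and \<mu> + \<nu> < 1 persist nearby. Only \<nu> \<ge> 0 remains, which is the
  condition on the side.\<close>

lemma triangle_contains_half_disc:
  assumes D: "cross2 (v - u) (w - u) \<noteq> 0" and x: "x \<in> open_segment u v"
  shows "\<forall>\<^sub>F y in nhds x. 0 \<le> cross2 (v - u) (y - u) * cross2 (v - u) (w - u) \<longrightarrow>
           y \<in> convex hull {u, v, w}"
proof -
  let ?D = "cross2 (v - u) (w - u)"
  define \<mu> where "\<mu> y = cross2 (y - u) (w - u) / ?D" for y
  define \<nu> where "\<nu> y = cross2 (v - u) (y - u) / ?D" for y
  obtain s where s: "0 < s" "s < 1" "x - u = s *\<^sub>R (v - u)"
    using x by (auto simp: in_segment algebra_simps)
  have x\<mu>\<nu>: "\<mu> x = s" "\<nu> x = 0"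
    using D by (auto simp: \<mu>_def \<nu>_def s(3) cross2_scaleR_right) (simp add: cross2_def algebra_simps divide_simps)
  have lim: "((\<lambda>y. \<mu> y) \<longlongrightarrow> \<mu> x) (nhds x)" "((\<lambda>y. \<mu> y + \<nu> y) \<longlongrightarrow> \<mu> x + \<nu> x) (nhds x)"
    unfolding \<mu>_def \<nu>_def cross2_def by (intro tendsto_intros filterlim_ident D[unfolded cross2_def])+
  have "\<forall>\<^sub>F y in nhds x. 0 < \<mu> y" "\<forall>\<^sub>F y in nhds x. \<mu> y + \<nu> y < 1"
    using lim s x\<mu>\<nu> by (auto intro: order_tendstoD)
  then show ?thesis
  proof eventually_elim
    case (elim y)
    show ?case
    proof
      assume "0 \<le> cross2 (v - u) (y - u) * ?D"
      then have "0 \<le> \<nu> y"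
        using D by (simp add: \<nu>_def zero_le_mult_iff zero_le_divide_iff)
      moreover have "y - u = \<mu> y *\<^sub>R (v - u) + \<nu> y *\<^sub>R (w - u)"
        unfolding \<mu>_def \<nu>_def by (rule cramer2[OF D])
      then have "y = u + \<mu> y *\<^sub>R (v - u) + \<nu> y *\<^sub>R (w - u)"
        by (simp add: algebra_simps)
      ultimately show "y \<in> convex hull {u, v, w}"
        unfolding convex_hull_3_alt using elim less_imp_le[of "0::real"] less_imp_le[of _ "1::real"] by blast
    qed
  qed
qed

text \<open>The strict condition on the side is open, so near \<open>x\<close> it cuts out an open
  subset of the triangle.\<close>

lemma triangle_interior_half_disc:
  assumes D: "cross2 (v - u) (w - u) \<noteq> 0" and x: "x \<in> open_segment u v"
  shows "\<forall>\<^sub>F y in nhds x. 0 < cross2 (v - u) (y - u) * cross2 (v - u) (w - u) \<longrightarrow>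
           y \<in> interior (convex hull {u, v, w})"
proof -
  let ?H = "{y. 0 < cross2 (v - u) (y - u) * cross2 (v - u) (w - u)}"
  obtain S where S: "open S" "x \<in> S"
    "\<And>y. y \<in> S \<Longrightarrow> 0 \<le> cross2 (v - u) (y - u) * cross2 (v - u) (w - u) \<Longrightarrow> y \<in> convex hull {u, v, w}"
    using triangle_contains_half_disc[OF assms] by (auto simp: eventually_nhds)
  have "open (S \<inter> ?H)"
    unfolding cross2_def by (intro open_Int S open_Collect_less continuous_intros)
  moreover have "S \<inter> ?H \<subseteq> convex hull {u, v, w}"
    using S(3) by auto
  ultimately have "S \<inter> ?H \<subseteq> interior (convex hull {u, v, w})"
    by (rule interior_maximal[rotated])
  then show ?thesis
    using S(1,2) by (auto simp: eventually_nhds)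
qed

subsection \<open>Triangles around an edge or a vertex\<close>

lemma cross2_perp_diff_pos: "u \<noteq> v \<Longrightarrow> 0 < cross2 (v - u) (perp (v - u))"
  by (rule cross2_perp_pos) simp

lemma cross2_normal_offset:
  assumes "x \<in> closed_segment u v"
  shows "cross2 (v - u) (x + t *\<^sub>R perp (v - u) - u) = t * cross2 (v - u) (perp (v - u))"
proof -
  have "cross2 (v - u) (x + t *\<^sub>R perp (v - u) - u) =
      cross2 (v - u) (x - u) + cross2 (v - u) (t *\<^sub>R perp (v - u))"
    by (simp add: cross2_add_right[symmetric] algebra_simps)
  then show ?thesis
    using cross2_closed_segment[OF assms] by (simp add: cross2_scaleR_right)
qed

lemma eventually_nhds_along_ray:
  assumes "eventually P (nhds (x::real^2))"
  shows "eventually (\<lambda>t. P (x + t *\<^sub>R d)) (at_right 0)"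
proof -
  have "((\<lambda>t. x + t *\<^sub>R d) \<longlongrightarrow> x + 0 *\<^sub>R d) (at_right 0)"
    by (intro tendsto_intros)
  then show ?thesis
    using eventually_compose_filterlim[OF assms] by simp
qed

lemma
  assumes "triangulation_of \<T> \<Omega>"
  shows triangulation_finite: "finite \<T>"
    and triangulation_simplex: "K \<in> \<T> \<Longrightarrow> 2 simplex K"
    and triangulation_Union: "\<Union>\<T> = closure \<Omega>"
    and triangulation_Int_face: "K \<in> \<T> \<Longrightarrow> L \<in> \<T> \<Longrightarrow> K \<inter> L face_of K"
      "K \<in> \<T> \<Longrightarrow> L \<in> \<T> \<Longrightarrow> K \<inter> L face_of L"
  using assms unfolding triangulation_of_def triangulation_def by (auto, metis Int_commute)

text \<open>Otherwise \<open>K\<close> would be a proper face of \<open>L\<close> and so of smaller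
  dimension, but both have dimension 2.\<close>

lemma triangulation_subset_eq:
  assumes "triangulation_of \<T> \<Omega>" "K \<in> \<T>" "L \<in> \<T>" "K \<subseteq> L"
  shows "K = L"
proof (rule ccontr)
  assume "K \<noteq> L"
  moreover have "K face_of L"
    using triangulation_Int_face(2)[OF assms(1-3)] assms(4) by (simp add: Int_absorb2)
  ultimately have "aff_dim K < aff_dim L"
    using face_of_aff_dim_lt[of L K] triangulation_simplex[OF assms(1,3)] convex_simplex by blast
  then show False
    using aff_dim_simplex[OF triangulation_simplex[OF assms(1,2)]]
      aff_dim_simplex[OF triangulation_simplex[OF assms(1,3)]] by simp
qed

text \<open>A face that meets the relative interior of a subset contains the whole subset.\<close>

lemma face_through_edge:
  fixes M :: "(real^2) set"
  assumes "closed_segment u v edge_of M" "F face_of M" "x \<in> F" "x \<in> open_segment u v"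
  shows "closed_segment u v \<subseteq> F"
proof (rule subset_of_face_of[OF assms(2)])
  show "closed_segment u v \<subseteq> M"
    using assms(1) by (rule edge_of_imp_subset)
  show "F \<inter> rel_interior (closed_segment u v) \<noteq> {}"
    using assms(3,4) by (auto simp: rel_interior_closed_segment)
qed

text \<open>The common face of \<open>K\<close> and \<open>L\<close> contains a relatively interior
  point of the edge, hence all of the edge. The edge is then a face of this face, and faces are
  transitive.\<close>

lemma edge_of_triangle_through_edge_point:
  assumes T: "triangulation_of \<T> \<Omega>" and KL: "K \<in> \<T>" "L \<in> \<T>"
    and e: "closed_segment u v edge_of K" and x: "x \<in> open_segment u v" "x \<in> L"
  shows "closed_segment u v edge_of L"
proof -
  have "closed_segment u v \<subseteq> K \<inter> L"
  proof (rule face_through_edge[OF e triangulation_Int_face(1)[OF T KL] _ x(1)])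
    show "x \<in> K \<inter> L"
      using x edge_of_imp_subset[OF e] by (auto simp: open_segment_def)
  qed
  then have "closed_segment u v face_of K \<inter> L"
    using e by (auto simp: edge_of_def intro: face_of_subset)
  then show ?thesis
    using e face_of_trans triangulation_Int_face(2)[OF T KL] by (auto simp: edge_of_def)
qed

text \<open>The edge \<open>e'\<close> contains the segment as a face, and two faces of equal
  dimension, one within the other, coincide.\<close>

lemma edges_meeting_in_open_segment:
  fixes M :: "(real^2) set"
  assumes e: "closed_segment u v edge_of M" and e': "e' edge_of M"
    and "x \<in> open_segment u v" "x \<in> e'"
  shows "e' = closed_segment u v"
proof (rule ccontr)
  assume neq: "e' \<noteq> closed_segment u v"
  have sub: "closed_segment u v \<subseteq> e'"
    using face_through_edge[OF e _ assms(4,3)] e' by (simp add: edge_of_def)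
  then have "closed_segment u v face_of e'"
    using e e' by (meson edge_of_def face_of_face)
  then have "aff_dim (closed_segment u v) < aff_dim e'"
    using neq e' by (intro face_of_aff_dim_lt) (auto simp: edge_of_def dest: face_of_imp_convex)
  then show False
    using e e' by (simp add: edge_of_def)
qed

text \<open>Two triangles on the same side would share a half disc at the midpoint of the edge.
  Their common face would then properly contain the edge, so that its dimension exceeds 1, while as
  a proper face of \<open>K\<close> it has dimension at most 1.\<close>

lemma triangles_on_opposite_sides:
  assumes T: "triangulation_of \<T> \<Omega>" and KL: "K \<in> \<T>" "L \<in> \<T>" "K \<noteq> L"
    and e: "closed_segment u v edge_of K" "closed_segment u v edge_of L"
    and K: "K = convex hull {u, v, w}" "cross2 (v - u) (w - u) \<noteq> 0"
    and L: "L = convex hull {u, v, w'}" "cross2 (v - u) (w' - u) \<noteq> 0"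
  shows "cross2 (v - u) (w - u) * cross2 (v - u) (w' - u) < 0"
proof (rule ccontr)
  let ?C = "\<lambda>y. cross2 (v - u) (y - u)"
  assume "\<not> ?C w * ?C w' < 0"
  then have same: "0 < ?C w * ?C w'"
    using K(2) L(2) by (metis less_linear mult_eq_0_iff)
  have uv: "u \<noteq> v"
    using K(2) by auto
  define x where "x = midpoint u v"
  have x: "x \<in> open_segment u v"
    using uv by (simp add: x_def)
  \<comment> \<open>Scaling the normal by the determinant at \<open>w\<close> makes \<open>d\<close>
    point to the side of \<open>w\<close> in either orientation.\<close>
  define d where "d = ?C w *\<^sub>R perp (v - u)"
  have C: "?C (x + t *\<^sub>R d) = t * ?C w * cross2 (v - u) (perp (v - u))" for t
    using cross2_normal_offset[of x u v "t * ?C w"] x by (simp add: open_segment_def d_def)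
  have "\<forall>\<^sub>F t in at_right 0. x + t *\<^sub>R d \<in> K \<inter> L - closed_segment u v"
    using eventually_nhds_along_ray[OF triangle_contains_half_disc[OF K(2) x], of d]
      eventually_nhds_along_ray[OF triangle_contains_half_disc[OF L(2) x], of d]
      eventually_at_right_less[of "0::real"]
  proof eventually_elim
    case (elim t)
    have "0 < t * cross2 (v - u) (perp (v - u))"
      using elim(3) cross2_perp_diff_pos[OF uv] by simp
    moreover have "0 < ?C w * ?C w"
      using K(2) by (auto simp: zero_less_mult_iff linorder_neq_iff)
    ultimately have pos: "0 < ?C (x + t *\<^sub>R d) * ?C w" "0 < ?C (x + t *\<^sub>R d) * ?C w'"
      using mult_pos_pos[of "t * cross2 (v - u) (perp (v - u))" "?C w * ?C w"]
        mult_pos_pos[of "t * cross2 (v - u) (perp (v - u))" "?C w * ?C w'"] same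
      unfolding C by (simp_all add: mult_ac)
    moreover have "x + t *\<^sub>R d \<notin> closed_segment u v"
      using pos(1) cross2_closed_segment[of "x + t *\<^sub>R d" u v] by auto
    ultimately show ?case
      using elim(1,2) K(1) L(1) by simp
  qed
  then obtain y where y: "y \<in> K \<inter> L" "y \<notin> closed_segment u v"
    by (auto dest!: eventually_happens'[rotated])
  have face: "K \<inter> L face_of K"
    using triangulation_Int_face(1)[OF T KL(1,2)] .
  have "K \<inter> L \<noteq> K"
    using triangulation_subset_eq[OF T KL(1,2)] KL(3) by auto
  then have "aff_dim (K \<inter> L) < aff_dim K"
    using face_of_aff_dim_lt[OF convex_simplex face] triangulation_simplex[OF T KL(1)] by blast
  then have dim: "aff_dim (K \<inter> L) \<le> 1"
    using aff_dim_simplex[OF triangulation_simplex[OF T KL(1)]] by simp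
  have "closed_segment u v face_of K \<inter> L"
    using e by (auto simp: edge_of_def intro: face_of_subset dest: face_of_imp_subset)
  then have "aff_dim (closed_segment u v) < aff_dim (K \<inter> L)"
    using y face_of_aff_dim_lt[of "K \<inter> L" "closed_segment u v"] face face_of_imp_convex by blast
  then show False
    using dim e(1) by (simp add: edge_of_def)
qed

text \<open>A short step from \<open>x\<close> across the edge, away from \<open>K\<close>, stays in
  \<Omega> and so ends in some triangle. That triangle also contains \<open>x\<close> and hence has
  the edge as a side.\<close>

lemma interior_edge_other_triangle:
  assumes T: "triangulation_of \<T> \<Omega>" and "open \<Omega>" and K: "K \<in> \<T>"
    and e: "closed_segment u v edge_of K" and x: "x \<in> open_segment u v" "x \<in> \<Omega>"
  obtains L where "L \<in> \<T>" "L \<noteq> K" "closed_segment u v edge_of L"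
proof -
  let ?C = "\<lambda>y. cross2 (v - u) (y - u)"
  obtain w where w: "K = convex hull {u, v, w}" "?C w \<noteq> 0" "u \<noteq> v"
    using edge_of_triangleE[OF triangulation_simplex[OF T K] e] .
  define d where "d = (- ?C w) *\<^sub>R perp (v - u)"
  have "\<forall>\<^sub>F y in nhds x. y \<in> \<Omega>"
    using x(2) \<open>open \<Omega>\<close> by (rule eventually_nhds_in_open[rotated])
  \<comment> \<open>There are finitely many triangles, all closed, so those that miss
    \<open>x\<close> also miss a neighbourhood of \<open>x\<close>.\<close>
  moreover have "\<forall>\<^sub>F y in nhds x. \<forall>L\<in>\<T>. y \<in> L \<longrightarrow> x \<in> L"
  proof (rule eventually_ball_finite[OF triangulation_finite[OF T]], rule ballI)
    fix L assume "L \<in> \<T>"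
    then have "open (- L)"
      using triangulation_simplex[OF T] closed_simplex by blast
    then show "\<forall>\<^sub>F y in nhds x. y \<in> L \<longrightarrow> x \<in> L"
      using eventually_nhds_in_open[of "- L" x] by (cases "x \<in> L") (auto elim: eventually_mono)
  qed
  ultimately have "\<forall>\<^sub>F y in nhds x. y \<in> \<Omega> \<and> (\<forall>L\<in>\<T>. y \<in> L \<longrightarrow> x \<in> L)"
    by (rule eventually_conj)
  from eventually_conj[OF eventually_at_right_less[of "0::real"] eventually_nhds_along_ray[OF this, of d]]
  obtain t where t: "0 < t" "x + t *\<^sub>R d \<in> \<Omega>" "\<And>L. L \<in> \<T> \<Longrightarrow> x + t *\<^sub>R d \<in> L \<Longrightarrow> x \<in> L"
    by (auto dest!: eventually_happens'[rotated])
  then obtain L where L: "L \<in> \<T>" "x + t *\<^sub>R d \<in> L"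
    using triangulation_Union[OF T] closure_subset by blast
  have "?C (x + t *\<^sub>R d) = - (t * ?C w * cross2 (v - u) (perp (v - u)))"
    using cross2_normal_offset[of x u v "t * - ?C w"] x(1) by (simp add: open_segment_def d_def)
  then have "?C (x + t *\<^sub>R d) * ?C w = - (t * cross2 (v - u) (perp (v - u)) * (?C w * ?C w))"
    by simp
  moreover have "0 < ?C w * ?C w"
    using w(2) by (auto simp: zero_less_mult_iff linorder_neq_iff)
  ultimately have "?C (x + t *\<^sub>R d) * ?C w < 0"
    using t(1) cross2_perp_diff_pos[OF w(3)] by simp
  then have "L \<noteq> K"
    using L(2) triangle_side[of "x + t *\<^sub>R d" u v w] w(1) by auto
  then show ?thesis
    using that[OF L(1)] edge_of_triangle_through_edge_point[OF T K L(1) e x(1)] t(3)[OF L] by blast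
qed

text \<open>A third triangle on the edge would give three real numbers with pairwise negative
  products.\<close>

lemma card_triangles_at_interior_edge:
  assumes T: "triangulation_of \<T> \<Omega>" and "open \<Omega>" and K: "K \<in> \<T>"
    and e: "closed_segment u v edge_of K" and x: "x \<in> open_segment u v" "x \<in> \<Omega>"
  shows "card {K \<in> \<T>. closed_segment u v edge_of K} = 2"
proof -
  obtain L where L: "L \<in> \<T>" "L \<noteq> K" "closed_segment u v edge_of L"
    using interior_edge_other_triangle[OF assms] .
  have "M = K \<or> M = L" if M: "M \<in> \<T>" "closed_segment u v edge_of M" for M
  proof (rule ccontr)
    assume *: "\<not> (M = K \<or> M = L)"
    note E = edge_of_triangleE[OF triangulation_simplex[OF T]]
    obtain a where a: "K = convex hull {u, v, a}" "cross2 (v - u) (a - u) \<noteq> 0"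
      using E[OF K e] by blast
    obtain b where b: "L = convex hull {u, v, b}" "cross2 (v - u) (b - u) \<noteq> 0"
      using E[OF L(1,3)] by blast
    obtain c where c: "M = convex hull {u, v, c}" "cross2 (v - u) (c - u) \<noteq> 0"
      using E[OF M] by blast
    have "cross2 (v - u) (a - u) * cross2 (v - u) (b - u) < 0"
      using triangles_on_opposite_sides[OF T K L(1) _ e L(3) a b] L(2) by simp
    moreover have "cross2 (v - u) (a - u) * cross2 (v - u) (c - u) < 0"
      using triangles_on_opposite_sides[OF T K M(1) _ e M(2) a c] * by auto
    moreover have "cross2 (v - u) (b - u) * cross2 (v - u) (c - u) < 0"
      using triangles_on_opposite_sides[OF T L(1) M(1) _ L(3) M(2) b c] * by auto
    ultimately show False
      by (auto simp: mult_less_0_iff)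
  qed
  then have "{K \<in> \<T>. closed_segment u v edge_of K} = {K, L}"
    using K L e by auto
  then show ?thesis
    using L(2) by simp
qed

section \<open>Counting triangles and edges at a vertex\<close>

definition triangulation_edges :: "(real^2) set set \<Rightarrow> (real^2) set set" where
  "triangulation_edges \<T> = {e. \<exists>K\<in>\<T>. e edge_of K}"

lemma finite_triangulation_edges:
  assumes T: "triangulation_of \<T> \<Omega>"
  shows "finite (triangulation_edges \<T>)"
proof -
  have "finite {e. e edge_of K}" if "K \<in> \<T>" for K
    using finite_polytope_faces[OF simplex_imp_polytope[OF triangulation_simplex[OF T that]]]
    by (rule rev_finite_subset) (auto simp: edge_of_def)
  moreover have "triangulation_edges \<T> = (\<Union>K\<in>\<T>. {e. e edge_of K})"
    by (auto simp: triangulation_edges_def)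
  ultimately show ?thesis
    using triangulation_finite[OF T] by simp
qed

lemma card_edges_of_triangle_at_vertex:
  assumes "2 simplex K" "\<xi> extreme_point_of K"
  shows "card {e. e edge_of K \<and> \<xi> extreme_point_of e} = 2"
proof -
  obtain u v w where K: "\<not> affine_dependent {u, v, w}" "u \<noteq> v" "u \<noteq> w" "v \<noteq> w"
    "K = convex hull {u, v, w}"
    using triangleE[OF assms(1)] .
  then have "\<xi> \<in> {u, v, w}"
    using assms(2) extreme_point_of_convex_hull by blast
  then obtain a b where ab: "{u, v, w} = {\<xi>, a, b}" "\<xi> \<noteq> a" "\<xi> \<noteq> b" "a \<noteq> b"
    using K(2-4) by auto
  have "e edge_of K \<and> \<xi> extreme_point_of e \<longleftrightarrow> e \<in> {closed_segment \<xi> a, closed_segment \<xi> b}" for e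
    unfolding K(5) edge_of_convex_hull_iff[OF K(1)] unfolding ab(1)
    using ab(2-4) by (auto simp: extreme_point_of_segment closed_segment_commute)
  moreover have "closed_segment \<xi> a \<noteq> closed_segment \<xi> b"
    using ab by (auto simp: doubleton_eq_iff)
  ultimately have "{e. e edge_of K \<and> \<xi> extreme_point_of e} = {closed_segment \<xi> a, closed_segment \<xi> b}"
      "closed_segment \<xi> a \<noteq> closed_segment \<xi> b"
    by blast+
  then show ?thesis
    by (simp del: closed_segment_eq)
qed

text \<open>Close to the end that lies in \<Omega> the edge runs inside \<Omega>. This gives the
  relatively interior point that counting the triangles on an edge requires.\<close>

lemma edge_at_interior_vertex_point:
  fixes \<Omega> :: "(real^2) set"
  assumes "open \<Omega>" "\<xi> \<in> \<Omega>" "\<xi> extreme_point_of closed_segment u v" "u \<noteq> v"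
  obtains x where "x \<in> open_segment u v" "x \<in> \<Omega>"
proof -
  have "\<exists>x\<in>open_segment a b. x \<in> \<Omega>" if ab: "a \<noteq> b" "a \<in> \<Omega>" for a b
  proof -
    have "\<forall>\<^sub>F t in at_right 0. a + t *\<^sub>R (b - a) \<in> \<Omega>"
      using eventually_nhds_along_ray[of "\<lambda>x. x \<in> \<Omega>" a "b - a"] eventually_nhds_in_open[OF assms(1) ab(2)]
      by simp
    moreover have "\<forall>\<^sub>F t in at_right (0::real). t \<in> {0<..<1}"
      by (rule eventually_at_right_real) simp
    ultimately have "\<forall>\<^sub>F t in at_right 0. a + t *\<^sub>R (b - a) \<in> \<Omega> \<and> t \<in> {0<..<1}"
      by (rule eventually_conj)
    then obtain t where "a + t *\<^sub>R (b - a) \<in> \<Omega>" "0 < t" "t < 1"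
      by (auto dest!: eventually_happens'[rotated])
    then show ?thesis
      using ab(1) by (intro bexI[of _ "a + t *\<^sub>R (b - a)"]) (auto simp: in_segment algebra_simps)
  qed
  from this[of u v] this[of v u] show ?thesis
    using that assms by (auto simp: extreme_point_of_segment open_segment_commute)
qed

lemma extreme_point_of_edge:
  "e edge_of K \<Longrightarrow> \<xi> extreme_point_of e \<Longrightarrow> \<xi> extreme_point_of K"
  by (auto simp: edge_of_def extreme_point_of_face)

lemma card_triangles_at_edge_of_interior_vertex:
  assumes T: "triangulation_of \<T> \<Omega>" and "open \<Omega>" "\<xi> \<in> \<Omega>"
    and e: "e \<in> triangulation_edges \<T>" "\<xi> extreme_point_of e"
  shows "card {K \<in> \<T>. e edge_of K} = 2"
proof -
  obtain K where K: "K \<in> \<T>" "e edge_of K"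
    using e(1) by (auto simp: triangulation_edges_def)
  obtain u v where uv: "e = closed_segment u v" "u \<noteq> v"
    using edge_ofE[OF triangulation_simplex[OF T K(1)] K(2)] .
  obtain x where "x \<in> open_segment u v" "x \<in> \<Omega>"
    using edge_at_interior_vertex_point[OF assms(2,3)] e(2) uv by blast
  then show ?thesis
    using card_triangles_at_interior_edge[OF T assms(2) K(1)] K(2) uv(1) by blast
qed

text \<open>Both sides count the pairs of a triangle in \<open>A\<close> and a side of it ending at
  \<xi>. The case \<open>k = 2\<close> serves the whole triangulation, the case \<open>k = 1\<close>
  a single class of a bipartition.\<close>

lemma double_count_at_vertex:
  assumes T: "triangulation_of \<T> \<Omega>" and "A \<subseteq> \<T>"
    and k: "\<And>e. e \<in> triangulation_edges \<T> \<Longrightarrow> \<xi> extreme_point_of e \<Longrightarrow> card {K \<in> A. e edge_of K} = k"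
  shows "2 * card {K \<in> A. \<xi> extreme_point_of K} =
         k * card {e \<in> triangulation_edges \<T>. \<xi> extreme_point_of e}"
proof -
  let ?S = "{K \<in> A. \<xi> extreme_point_of K}"
  let ?E = "{e \<in> triangulation_edges \<T>. \<xi> extreme_point_of e}"
  have fin: "finite ?S" "finite ?E"
    using finite_subset[OF \<open>A \<subseteq> \<T>\<close> triangulation_finite[OF T]] finite_triangulation_edges[OF T]
    by auto
  have "(\<Sum>K\<in>?S. card {e \<in> ?E. e edge_of K}) = (\<Sum>e\<in>?E. k)"
  proof (rule sum_multicount_gen[OF fin], rule ballI)
    fix e assume e: "e \<in> ?E"
    have "{K \<in> ?S. e edge_of K} = {K \<in> A. e edge_of K}"
      using e extreme_point_of_edge by blast
    then show "card {K \<in> ?S. e edge_of K} = k"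
      using k e by simp
  qed
  moreover have "card {e \<in> ?E. e edge_of K} = 2" if "K \<in> ?S" for K
  proof -
    have "{e \<in> ?E. e edge_of K} = {e. e edge_of K \<and> \<xi> extreme_point_of e}"
      using that \<open>A \<subseteq> \<T>\<close> by (auto simp: triangulation_edges_def)
    then show ?thesis
      using card_edges_of_triangle_at_vertex[of K \<xi>] that \<open>A \<subseteq> \<T>\<close> triangulation_simplex[OF T] by auto
  qed
  ultimately show ?thesis
    by (simp add: mult.commute)
qed

text \<open>Conformity excludes hanging vertices: a corner of \<open>L\<close> lying in
  \<open>K\<close> is extreme in the common face, hence in \<open>K\<close>. Incidence can therefore
  be counted by corners.\<close>

lemma vertex_of_incident_triangle:
  assumes T: "triangulation_of \<T> \<Omega>" and \<xi>: "\<xi> \<in> triangulation_vertices \<T>" and K: "K \<in> \<T>"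
  shows "\<xi> \<in> frontier K \<longleftrightarrow> \<xi> extreme_point_of K"
proof
  assume "\<xi> \<in> frontier K"
  then have "\<xi> \<in> K"
    using closed_simplex[OF triangulation_simplex[OF T K]] frontier_subset_closed by blast
  obtain L where L: "L \<in> \<T>" "\<xi> extreme_point_of L"
    using \<xi> by (auto simp: triangulation_vertices_def)
  then have "\<xi> extreme_point_of K \<inter> L"
    using \<open>\<xi> \<in> K\<close> extreme_point_of_face[OF triangulation_Int_face(2)[OF T K L(1)]]
    by (auto simp: extreme_point_of_def)
  then show "\<xi> extreme_point_of K"
    using extreme_point_of_face[OF triangulation_Int_face(1)[OF T K L(1)]] by blast
next
  assume "\<xi> extreme_point_of K"
  then have "\<xi> \<notin> interior K" "\<xi> \<in> K"
    by (auto simp: extreme_point_not_in_interior extreme_point_of_def)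
  then show "\<xi> \<in> frontier K"
    using closure_subset by (auto simp: frontier_def)
qed

lemma card_incident_triangles:
  assumes "triangulation_of \<T> \<Omega>" "open \<Omega>" "\<xi> \<in> interior_vertices \<T> \<Omega>"
  shows "card {K \<in> \<T>. \<xi> \<in> frontier K} =
         card {e \<in> triangulation_edges \<T>. \<xi> extreme_point_of e}"
proof -
  have \<xi>: "\<xi> \<in> triangulation_vertices \<T>" "\<xi> \<in> \<Omega>"
    using assms(2,3) by (auto simp: interior_vertices_def interior_open)
  have "{K \<in> \<T>. \<xi> \<in> frontier K} = {K \<in> \<T>. \<xi> extreme_point_of K}"
    using vertex_of_incident_triangle[OF assms(1) \<xi>(1)] by blast
  then show ?thesis
    using double_count_at_vertex[OF assms(1) order_refl, of \<xi> 2]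
      card_triangles_at_edge_of_interior_vertex[OF assms(1,2) \<xi>(2)] by simp
qed

lemma bipartite_imp_even:
  assumes T: "triangulation_of \<T> \<Omega>" and "open \<Omega>" and \<xi>: "\<xi> \<in> interior_vertices \<T> \<Omega>"
    and bip: "bipartite_triangulation \<T>"
  shows "even (card {K \<in> \<T>. \<xi> \<in> frontier K})"
proof -
  have \<xi>': "\<xi> \<in> triangulation_vertices \<T>" "\<xi> \<in> \<Omega>"
    using assms(2,3) by (auto simp: interior_vertices_def interior_open)
  obtain A B where AB: "A \<union> B = \<T>" "A \<inter> B = {}"
    "\<And>K L. (K, L) \<in> triangle_arcs \<T> \<Longrightarrow> K \<in> A \<and> L \<in> B \<or> K \<in> B \<and> L \<in> A"
    using bip unfolding bipartite_triangulation_def bipartite_graph_def by fast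
  have one: "card {K \<in> A. e edge_of K} = 1 \<and> card {K \<in> B. e edge_of K} = 1"
    if e: "e \<in> triangulation_edges \<T>" "\<xi> extreme_point_of e" for e
  proof -
    \<comment> \<open>The two triangles on \<open>e\<close> are joined by an arc, so each class
      receives exactly one of them.\<close>
    obtain K L where KL: "{K \<in> \<T>. e edge_of K} = {K, L}" "K \<noteq> L"
      using card_triangles_at_edge_of_interior_vertex[OF T assms(2) \<xi>'(2) e]
      by (auto simp: card_2_iff)
    then have "(K, L) \<in> triangle_arcs \<T>"
      by (auto simp: triangle_arcs_def)
    then have "K \<in> A \<and> L \<in> B \<or> K \<in> B \<and> L \<in> A"
      by (rule AB(3))
    moreover have "{K \<in> A. e edge_of K} = {K, L} \<inter> A" "{K \<in> B. e edge_of K} = {K, L} \<inter> B"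
      unfolding KL(1)[symmetric] using AB(1) by auto
    ultimately show ?thesis
      using KL(2) AB(2) by (auto simp: Int_insert_left)
  qed
  let ?A = "{K \<in> A. \<xi> extreme_point_of K}" and ?B = "{K \<in> B. \<xi> extreme_point_of K}"
  have "2 * card ?A = 2 * card ?B"
    using double_count_at_vertex[OF T, of A \<xi> 1] double_count_at_vertex[OF T, of B \<xi> 1] one AB(1)
    by auto
  moreover have "{K \<in> \<T>. \<xi> \<in> frontier K} = ?A \<union> ?B"
    using vertex_of_incident_triangle[OF T \<xi>'(1)] AB(1) by blast
  moreover have "card (?A \<union> ?B) = card ?A + card ?B"
    using triangulation_finite[OF T] AB(1,2) by (intro card_Un_disjoint) auto
  ultimately show ?thesis
    by simp
qed

subsection \<open>Square roots cut along an edge\<close>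

text \<open>For \<open>z = v\<close> the quotient is \<open>0\<close> by convention and the value is \<open>0\<close>, as it should be.\<close>

definition seg_root :: "complex \<Rightarrow> complex \<Rightarrow> complex \<Rightarrow> complex" where
  "seg_root u v z = (z - v) * csqrt ((z - u) / (z - v))"

lemma seg_root_square: "(seg_root u v z)\<^sup>2 = (z - u) * (z - v)"
  by (cases "z = v") (simp_all add: seg_root_def power_mult_distrib power2_eq_square[of "z - v"])

text \<open>The principal root is continuous off the nonpositive reals. If the quotient is a real
  number \<open>r\<close> with \<open>r \<le> 0\<close>, then \<open>z\<close> is the convex
  combination of \<open>u\<close> and \<open>v\<close> in which \<open>v\<close> has weight
  \<open>- r / (1 - r)\<close>.\<close>

lemma isCont_seg_root:
  assumes "z \<notin> closed_segment u v"
  shows "isCont (seg_root u v) z"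
proof -
  have "z \<noteq> v"
    using assms by auto
  have "(z - u) / (z - v) \<notin> \<real>\<^sub>\<le>\<^sub>0"
  proof
    assume "(z - u) / (z - v) \<in> \<real>\<^sub>\<le>\<^sub>0"
    then obtain r where r: "(z - u) / (z - v) = of_real r" "r \<le> 0"
      by (auto elim: nonpos_Reals_cases)
    then have "z - u = of_real r * (z - v)"
      using \<open>z \<noteq> v\<close> by (simp add: field_simps)
    then have "of_real (1 - r) * z = u - of_real r * v"
      by (simp add: algebra_simps)
    then have "z = (u - of_real r * v) / of_real (1 - r)"
      using r(2) by (simp add: eq_divide_eq mult.commute)
    also have "\<dots> = (1 / (1 - r)) *\<^sub>R u + (- r / (1 - r)) *\<^sub>R v"
      by (simp add: scaleR_conv_of_real diff_divide_distrib)
    also have "1 / (1 - r) = 1 - (- r / (1 - r))"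
      using r(2) by (simp add: field_simps)
    finally have "z = (1 - (- r / (1 - r))) *\<^sub>R u + (- r / (1 - r)) *\<^sub>R v" .
    moreover have "0 \<le> - r / (1 - r)" "- r / (1 - r) \<le> 1"
      using r(2) by (auto simp: field_simps)
    ultimately have "z \<in> closed_segment u v"
      unfolding in_segment by blast
    with assms show False ..
  qed
  then have "isCont (\<lambda>z. (z - v) * csqrt ((z - u) / (z - v))) z"
    using \<open>z \<noteq> v\<close> by (intro continuous_intros isCont_csqrt') auto
  then show ?thesis
    by (simp add: seg_root_def[abs_def])
qed

text \<open>The root evaluated on the perpendicular bisector: apart from \<open>sgn t\<close> the
  value is continuous and even in \<open>t\<close>, so the root changes sign across the
  segment.\<close>

lemma seg_root_normal:
  fixes m d :: complex and t :: real
  assumes "d \<noteq> 0" "t \<noteq> 0"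
  shows "seg_root (m - d) (m + d) (m + t *\<^sub>R (\<i> * d)) = sgn t *\<^sub>R (\<i> * d * sqrt (1 + t\<^sup>2))"
proof -
  \<comment> \<open>After moving \<open>m\<close> to 0 and dividing by \<open>d\<close>, the
    differences to the two ends become \<open>?w\<close> and \<open>- cnj ?w\<close>;
    \<open>?s\<close> is the modulus of \<open>?w\<close>.\<close>
  let ?w = "Complex 1 t" and ?s = "complex_of_real (sqrt (1 + t\<^sup>2))"
  have s: "?s \<noteq> 0" "?s\<^sup>2 = 1 + (of_real t)\<^sup>2"
    by (auto simp: add_nonneg_eq_0_iff simp flip: of_real_power)
  have w: "?w = 1 + of_real t * \<i>" "-1 + of_real t * \<i> \<noteq> 0" "cnj ?w = 1 - of_real t * \<i>"
    by (auto simp: complex_eq_iff)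
  have prod: "?w * cnj ?w = ?s\<^sup>2"
    unfolding w(1,3) s(2) by (simp add: algebra_simps power2_eq_square)
  have "(m + t *\<^sub>R (\<i> * d) - (m - d)) / (m + t *\<^sub>R (\<i> * d) - (m + d)) = (d * ?w) / (d * (- cnj ?w))"
    unfolding w(1,3) by (simp add: scaleR_conv_of_real algebra_simps)
  also have "\<dots> = - (?w / cnj ?w)"
    using assms(1) by simp
  \<comment> \<open>Of the two square roots, the factor \<open>- sgn t\<close> selects the one with
    positive real part, which is the principal one.\<close>
  also have "\<dots> = ((- sgn t) *\<^sub>R (\<i> * ?w / ?s))\<^sup>2"
  proof -
    have "cnj ?w \<noteq> 0" 
      by (auto simp: complex_eq_iff)
    then have "?w / cnj ?w = ?w\<^sup>2 / ?s\<^sup>2"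
      unfolding prod[symmetric] by (simp add: power2_eq_square)
    then show ?thesis
      using assms(2) by (simp add: power_mult_distrib power_divide sgn_if scaleR_conv_of_real)
  qed
  finally have eq: "((- sgn t) *\<^sub>R (\<i> * ?w / ?s))\<^sup>2 =
      (m + t *\<^sub>R (\<i> * d) - (m - d)) / (m + t *\<^sub>R (\<i> * d) - (m + d))" ..
  have "Re ((- sgn t) *\<^sub>R (\<i> * ?w / ?s)) = \<bar>t\<bar> / sqrt (1 + t\<^sup>2)"
    by (simp add: Re_divide_of_real abs_sgn)
  also have "\<dots> > 0"
    using assms(2) by (simp add: add_pos_nonneg)
  finally have "csqrt ((m + t *\<^sub>R (\<i> * d) - (m - d)) / (m + t *\<^sub>R (\<i> * d) - (m + d))) =
      (- sgn t) *\<^sub>R (\<i> * ?w / ?s)"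
    using csqrt_unique[OF eq] by blast
  then have "seg_root (m - d) (m + d) (m + t *\<^sub>R (\<i> * d)) =
      (d * (- cnj ?w)) * ((- sgn t) *\<^sub>R (\<i> * ?w / ?s))"
    unfolding seg_root_def w(3) by (simp add: scaleR_conv_of_real algebra_simps)
  also have "\<dots> = sgn t *\<^sub>R (\<i> * d * ((?w * cnj ?w) / ?s))"
    by (simp add: scaleR_conv_of_real)
  also have "(?w * cnj ?w) / ?s = ?s"
    unfolding prod using s(1) by (simp add: power2_eq_square)
  finally show ?thesis .
qed

section \<open>Edge roots and vertex roots on the real plane\<close>

definition cpx :: "real^2 \<Rightarrow> complex" where
  "cpx y = Complex (y$1) (y$2)"

lemma linear_cpx: "linear cpx"
  by (rule linearI) (simp_all add: cpx_def complex_eq_iff)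

lemma inj_cpx: "inj cpx"
  by (rule injI) (simp add: cpx_def vec_eq_iff forall_2)

lemma cpx_eq_iff [simp]: "cpx x = cpx y \<longleftrightarrow> x = y"
  by (rule inj_eq[OF inj_cpx])

lemma isCont_cpx [continuous_intros, simp]: "isCont cpx x"
  using linear_cpx by (intro linear_continuous_at linear_conv_bounded_linear[THEN iffD1])

lemma cpx_perp: "cpx (perp d) = \<i> * cpx d"
  by (simp add: cpx_def complex_eq_iff)

lemma cpx_mem_closed_segment:
  "cpx y \<in> closed_segment (cpx u) (cpx v) \<longleftrightarrow> y \<in> closed_segment u v"
  using closed_segment_linear_image[OF linear_cpx, of u v] inj_cpx by (auto simp: inj_image_mem_iff)

definition edge_root :: "real^2 \<Rightarrow> real^2 \<Rightarrow> real^2 \<Rightarrow> complex" where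
  "edge_root u v y = seg_root (cpx u) (cpx v) (cpx y)"

lemma edge_root_square: "(edge_root u v y)\<^sup>2 = (cpx y - cpx u) * (cpx y - cpx v)"
  by (simp add: edge_root_def seg_root_square)

lemma isCont_edge_root:
  assumes "y \<notin> closed_segment u v"
  shows "isCont (edge_root u v) y"
  unfolding edge_root_def[abs_def]
  using isCont_o2[OF isCont_cpx isCont_seg_root] assms cpx_mem_closed_segment by blast

text \<open>Here the normal has the full length of the edge, whereas \<open>seg_root_normal\<close>
  scales by the half edge \<open>d\<close>; hence the factor 2 at \<open>t\<close>.\<close>

lemma edge_root_normal:
  assumes "u \<noteq> v" "t \<noteq> 0"
  shows "edge_root u v (midpoint u v + t *\<^sub>R perp (v - u)) =
    sgn t *\<^sub>R (\<i> * (cpx (v - u) / 2) * sqrt (1 + (2 * t)\<^sup>2))"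
proof -
  interpret c: linear cpx by (rule linear_cpx)
  define m d where "m = cpx (midpoint u v)" and "d = cpx (v - u) / 2"
  have u: "cpx u = m - d"
    by (simp add: m_def d_def cpx_def complex_eq_iff midpoint_def field_simps)
  have v: "cpx v = m + d"
    by (simp add: m_def d_def cpx_def complex_eq_iff midpoint_def field_simps)
  have z: "cpx (midpoint u v + t *\<^sub>R perp (v - u)) = m + (2 * t) *\<^sub>R (\<i> * d)"
    by (simp add: m_def d_def c.add c.scaleR cpx_perp) (simp add: scaleR_conv_of_real)
  have "d \<noteq> 0"
    using assms(1) u v by (metis add.right_neutral cpx_eq_iff diff_zero)
  then have "seg_root (m - d) (m + d) (m + (2 * t) *\<^sub>R (\<i> * d)) =
      sgn (2 * t) *\<^sub>R (\<i> * d * sqrt (1 + (2 * t)\<^sup>2))"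
    by (rule seg_root_normal) (use assms in simp)
  moreover have "sgn (2 * t) = sgn t"
    by (simp add: sgn_mult)
  ultimately show ?thesis
    unfolding edge_root_def u v z d_def by simp
qed

text \<open>For \<xi> in \<Omega> the exponent is halved. For \<xi> outside, the linear factor has
  no zero on \<Omega> and thus has a continuous logarithm there, which is halved instead.\<close>

lemma vertex_factor_root:
  assumes "simply_connected \<Omega>" "open \<Omega>" and "\<xi> \<in> \<Omega> \<Longrightarrow> even n"
  obtains g where "continuous_on \<Omega> g" "\<And>y. y \<in> \<Omega> \<Longrightarrow> (g y)\<^sup>2 = (cpx y - cpx \<xi>) ^ n"
proof (cases "\<xi> \<in> \<Omega>")
  case True
  then obtain k where k: "n = 2 * k"
    using assms(3) by (auto elim: evenE)
  show ?thesis
  proof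
    show "continuous_on \<Omega> (\<lambda>y. (cpx y - cpx \<xi>) ^ k)"
      by (intro continuous_intros continuous_at_imp_continuous_on) auto
    show "((cpx y - cpx \<xi>) ^ k)\<^sup>2 = (cpx y - cpx \<xi>) ^ n" for y
      by (simp add: k power_mult[symmetric] mult.commute)
  qed
next
  case False
  have "continuous_on \<Omega> (\<lambda>y. cpx y - cpx \<xi>)"
    by (intro continuous_intros continuous_at_imp_continuous_on) auto
  moreover have "cpx y - cpx \<xi> \<noteq> 0" if "y \<in> \<Omega>" for y
    using that False by auto
  ultimately obtain g where g: "continuous_on \<Omega> g" "\<And>y. y \<in> \<Omega> \<Longrightarrow> cpx y - cpx \<xi> = exp (g y)"
    using continuous_logarithm_on_simply_connected[of \<Omega> "\<lambda>y. cpx y - cpx \<xi>"]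
      assms(1) open_imp_locally_path_connected[OF assms(2)] by blast
  show ?thesis
  proof
    show "continuous_on \<Omega> (\<lambda>y. exp (g y / 2) ^ n)"
      by (intro continuous_intros g(1)) auto
    fix y assume "y \<in> \<Omega>"
    have "(exp (g y / 2) ^ n)\<^sup>2 = ((exp (g y / 2))\<^sup>2) ^ n"
      by (simp add: power_mult[symmetric] mult.commute)
    also have "(exp (g y / 2))\<^sup>2 = exp (g y)"
      by (simp flip: exp_double)
    finally show "(exp (g y / 2) ^ n)\<^sup>2 = (cpx y - cpx \<xi>) ^ n"
      using g(2)[OF \<open>y \<in> \<Omega>\<close>] by simp
  qed
qed

text \<open>Fixes names for the two ends of every edge, as the edge roots take ends and not segments
  as arguments.\<close>

lemma edge_ends_exist:
  assumes "triangulation_of \<T> \<Omega>"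
  obtains a b where "\<And>e. e \<in> triangulation_edges \<T> \<Longrightarrow> e = closed_segment (a e) (b e) \<and> a e \<noteq> b e"
proof -
  have "\<exists>u v. e = closed_segment u v \<and> u \<noteq> v" if e: "e \<in> triangulation_edges \<T>" for e
  proof -
    obtain K where "K \<in> \<T>" "e edge_of K"
      using e by (auto simp: triangulation_edges_def)
    then show ?thesis
      using edge_ofE[OF triangulation_simplex[OF assms]] by metis
  qed
  then show ?thesis
    using that by metis
qed

section \<open>Open triangles and shared edges in the domain\<close>

lemma interior_triangle_disjoint_edge:
  assumes T: "triangulation_of \<T> \<Omega>" and K: "K \<in> \<T>" and e: "e \<in> triangulation_edges \<T>"
  shows "interior K \<inter> e = {}"
proof -
  obtain L where L: "L \<in> \<T>" "e edge_of L"
    using e by (auto simp: triangulation_edges_def)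
  show ?thesis
  proof (cases "K = L")
    case True
    have "e \<noteq> K"
      using L(2) aff_dim_simplex[OF triangulation_simplex[OF T K]] by (auto simp: edge_of_def)
    then show ?thesis
      using face_of_disjoint_interior[of e K] L(2) True by (auto simp: edge_of_def)
  next
    case False
    then have "K \<inter> L \<noteq> K"
      using triangulation_subset_eq[OF T K L(1)] by auto
    then have "K \<inter> L \<inter> interior K = {}"
      using face_of_disjoint_interior[OF triangulation_Int_face(1)[OF T K L(1)]] by simp
    then show ?thesis
      using edge_of_imp_subset[OF L(2)] interior_subset by blast
  qed
qed

text \<open>The triangles only cover the closure of \<Omega>; that \<Omega> is the interior of its
  closure brings open triangles back into \<Omega>, where the root \<open>G\<close> is
  defined.\<close>

lemma interior_triangle_subset:
  assumes T: "triangulation_of \<T> \<Omega>" and reg: "interior (closure \<Omega>) = \<Omega>" and K: "K \<in> \<T>"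
  shows "interior K \<subseteq> \<Omega>"
proof -
  have "K \<subseteq> closure \<Omega>"
    using triangulation_Union[OF T] K by blast
  then show ?thesis
    using interior_mono reg by blast
qed

text \<open>The two triangles lie on opposite sides, so their half discs fill a neighbourhood of
  \<open>x\<close> within the closure of \<Omega>.\<close>

lemma shared_edge_point_in_domain:
  assumes T: "triangulation_of \<T> \<Omega>" and reg: "interior (closure \<Omega>) = \<Omega>"
    and KL: "K \<in> \<T>" "L \<in> \<T>" "K \<noteq> L"
    and e: "closed_segment u v edge_of K" "closed_segment u v edge_of L"
    and x: "x \<in> open_segment u v"
  shows "x \<in> \<Omega>"
proof -
  let ?C = "\<lambda>y. cross2 (v - u) (y - u)"
  note E = edge_of_triangleE[OF triangulation_simplex[OF T]]
  obtain w where K: "K = convex hull {u, v, w}" "?C w \<noteq> 0"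
    using E[OF KL(1) e(1)] by blast
  obtain w' where L: "L = convex hull {u, v, w'}" "?C w' \<noteq> 0"
    using E[OF KL(2) e(2)] by blast
  have "?C w * ?C w' < 0"
    by (rule triangles_on_opposite_sides[OF T KL e K L])
  then have side: "0 \<le> ?C y * ?C w \<or> 0 \<le> ?C y * ?C w'" for y
    by (auto simp: mult_less_0_iff zero_le_mult_iff)
  have "\<forall>\<^sub>F y in nhds x. y \<in> K \<union> L"
    using triangle_contains_half_disc[OF K(2) x] triangle_contains_half_disc[OF L(2) x]
    by eventually_elim (use side K(1) L(1) in blast)
  then have "x \<in> interior (K \<union> L)"
    by (auto simp: eventually_nhds interior_def)
  moreover have "K \<union> L \<subseteq> closure \<Omega>"
    using triangulation_Union[OF T] KL by blast
  ultimately show ?thesis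
    using interior_mono reg by blast
qed

subsection \<open>The sign function\<close>

lemma sign_change_imp_zero:
  fixes H :: "real \<Rightarrow> complex"
  assumes "isCont H 0"
    and "\<forall>\<^sub>F t in at_right 0. H t = c" "\<forall>\<^sub>F t in at_left 0. H t = - c"
  shows "c = 0"
proof -
  have "(H \<longlongrightarrow> H 0) (at_right 0)" "(H \<longlongrightarrow> H 0) (at_left 0)"
    using assms(1) unfolding isCont_def by (simp_all add: filterlim_at_split)
  moreover have "(H \<longlongrightarrow> c) (at_right 0)" "(H \<longlongrightarrow> - c) (at_left 0)"
    using assms(2,3) by (auto intro: tendsto_eventually)
  ultimately have "H 0 = c" "H 0 = - c"
    using tendsto_unique[OF trivial_limit_at_right_real] tendsto_unique[OF trivial_limit_at_left_real]
    by blast+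
  then show ?thesis
    by simp
qed

text \<open>Each squared edge root is the product of the linear factors of its two ends. Regrouping
  by ends gives \<xi> the exponent \<open>deg \<xi>\<close>, and each such power has a continuous
  root by \<open>vertex_factor_root\<close>.\<close>

lemma even_imp_square_root_of_edge_product:
  assumes T: "triangulation_of \<T> \<Omega>" and sc: "simply_connected \<Omega>" and "open \<Omega>"
    and even: "\<And>\<xi>. \<xi> \<in> interior_vertices \<T> \<Omega> \<Longrightarrow> even (card {K \<in> \<T>. \<xi> \<in> frontier K})"
    and ab: "\<And>e. e \<in> triangulation_edges \<T> \<Longrightarrow> e = closed_segment (a e) (b e) \<and> a e \<noteq> b e"
  obtains G where "continuous_on \<Omega> G"
    "\<And>y. y \<in> \<Omega> \<Longrightarrow> (G y)\<^sup>2 = (\<Prod>e\<in>triangulation_edges \<T>. (edge_root (a e) (b e) y)\<^sup>2)"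
proof -
  let ?E = "triangulation_edges \<T>"
  define W where "W = (\<Union>e\<in>?E. {a e, b e})"
  define deg where "deg \<xi> = card {e \<in> ?E. \<xi> extreme_point_of e}" for \<xi>
  have finE: "finite ?E"
    by (rule finite_triangulation_edges[OF T])
  have finW: "finite W"
    using finE by (auto simp: W_def)
  have ext: "\<xi> extreme_point_of e \<longleftrightarrow> \<xi> = a e \<or> \<xi> = b e" if "e \<in> ?E" for e \<xi>
    using ab[OF that] extreme_point_of_segment[of \<xi> "a e" "b e"] by simp
  have deg_even: "even (deg \<xi>)" if "\<xi> \<in> W" "\<xi> \<in> \<Omega>" for \<xi>
  proof -
    have "\<xi> \<in> triangulation_vertices \<T>"
      using that(1) ext extreme_point_of_edge
      unfolding W_def triangulation_vertices_def triangulation_edges_def by blast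
    then have "\<xi> \<in> interior_vertices \<T> \<Omega>"
      using that(2) \<open>open \<Omega>\<close> by (simp add: interior_vertices_def interior_open)
    \<comment> \<open>The hypothesis speaks of triangles and \<open>deg\<close> of edges; at an
      interior vertex the two numbers agree.\<close>
    then show ?thesis
      using even card_incident_triangles[OF T \<open>open \<Omega>\<close>] by (simp add: deg_def)
  qed
  have "\<exists>g. continuous_on \<Omega> g \<and> (\<forall>y\<in>\<Omega>. (g y)\<^sup>2 = (cpx y - cpx \<xi>) ^ deg \<xi>)" if "\<xi> \<in> W" for \<xi>
    using vertex_factor_root[OF sc \<open>open \<Omega>\<close>, of \<xi> "deg \<xi>"] deg_even[OF that] by metis
  then obtain g where g: "\<And>\<xi>. \<xi> \<in> W \<Longrightarrow> continuous_on \<Omega> (g \<xi>)"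
    "\<And>\<xi> y. \<xi> \<in> W \<Longrightarrow> y \<in> \<Omega> \<Longrightarrow> (g \<xi> y)\<^sup>2 = (cpx y - cpx \<xi>) ^ deg \<xi>"
    by metis
  show ?thesis
  proof
    show "continuous_on \<Omega> (\<lambda>y. \<Prod>\<xi>\<in>W. g \<xi> y)"
      by (intro continuous_on_prod g(1))
    fix y assume y: "y \<in> \<Omega>"
    have "(\<Prod>\<xi>\<in>W. g \<xi> y)\<^sup>2 = (\<Prod>\<xi>\<in>W. \<Prod>e\<in>{e \<in> ?E. \<xi> extreme_point_of e}. cpx y - cpx \<xi>)"
      by (simp add: prod_power_distrib g(2) y deg_def)
    also have "\<dots> = (\<Prod>e\<in>?E. \<Prod>\<xi>\<in>{\<xi> \<in> W. \<xi> extreme_point_of e}. cpx y - cpx \<xi>)"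
      by (rule prod.swap_restrict[OF finW finE])
    also have "\<dots> = (\<Prod>e\<in>?E. (edge_root (a e) (b e) y)\<^sup>2)"
    proof (rule prod.cong[OF refl])
      fix e assume e: "e \<in> ?E"
      then have "{\<xi> \<in> W. \<xi> extreme_point_of e} = {a e, b e}"
        using ext by (auto simp: W_def)
      then show "(\<Prod>\<xi>\<in>{\<xi> \<in> W. \<xi> extreme_point_of e}. cpx y - cpx \<xi>) = (edge_root (a e) (b e) y)\<^sup>2"
        using ab[OF e] by (simp add: edge_root_square)
    qed
    finally show "(\<Prod>\<xi>\<in>W. g \<xi> y)\<^sup>2 = (\<Prod>e\<in>?E. (edge_root (a e) (b e) y)\<^sup>2)" .
  qed
qed

text \<open>The normal \<open>perp (v - u)\<close> points to the positive side of the edge, so the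
  sign of \<open>t\<close> decides the side. Stating it on a full neighbourhood of 0 covers both
  orientations of the triangle.\<close>

lemma eventually_normal_in_triangle_interior:
  assumes D: "cross2 (v - u) (w - u) \<noteq> 0" and x: "x \<in> open_segment u v"
  shows "\<forall>\<^sub>F t in nhds 0. 0 < t * cross2 (v - u) (w - u) \<longrightarrow>
           x + t *\<^sub>R perp (v - u) \<in> interior (convex hull {u, v, w})"
proof -
  have "u \<noteq> v"
    using D by auto
  have "((\<lambda>t. x + t *\<^sub>R perp (v - u)) \<longlongrightarrow> x + 0 *\<^sub>R perp (v - u)) (nhds 0)"
    by (intro tendsto_intros filterlim_ident)
  then have "\<forall>\<^sub>F t in nhds 0. 0 < cross2 (v - u) (x + t *\<^sub>R perp (v - u) - u) * cross2 (v - u) (w - u) \<longrightarrow>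
      x + t *\<^sub>R perp (v - u) \<in> interior (convex hull {u, v, w})"
    using eventually_compose_filterlim[OF triangle_interior_half_disc[OF D x]] by simp
  then show ?thesis
  proof eventually_elim
    case (elim t)
    then show ?case
      using cross2_perp_diff_pos[OF \<open>u \<noteq> v\<close>] x
      by (simp add: cross2_normal_offset open_segment_def zero_less_mult_iff mult_less_0_iff)
  qed
qed

lemma even_imp_bipartite:
  assumes T: "triangulation_of \<T> \<Omega>" and sc: "simply_connected \<Omega>" and "open \<Omega>"
    and reg: "interior (closure \<Omega>) = \<Omega>"
    and even: "\<And>\<xi>. \<xi> \<in> interior_vertices \<T> \<Omega> \<Longrightarrow> even (card {K \<in> \<T>. \<xi> \<in> frontier K})"
  shows "bipartite_triangulation \<T>"
proof -
  let ?E = "triangulation_edges \<T>"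
  obtain a b where ab: "\<And>e. e \<in> ?E \<Longrightarrow> e = closed_segment (a e) (b e) \<and> a e \<noteq> b e"
    using edge_ends_exist[OF T] by blast
  obtain G where G: "continuous_on \<Omega> G"
    "\<And>y. y \<in> \<Omega> \<Longrightarrow> (G y)\<^sup>2 = (\<Prod>e\<in>?E. (edge_root (a e) (b e) y)\<^sup>2)"
    using even_imp_square_root_of_edge_product[OF T sc \<open>open \<Omega>\<close> even ab] by blast
  have finE: "finite ?E"
    by (rule finite_triangulation_edges[OF T])
  define r where "r e = edge_root (a e) (b e)" for e
  define s where "s y = (\<Prod>e\<in>?E. r e y) / G y" for y
  have contG: "isCont G y" if "y \<in> \<Omega>" for y
    using G(1) \<open>open \<Omega>\<close> that by (simp add: continuous_on_eq_continuous_at)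
  have contr: "isCont (r e) y" if "e \<in> ?E" "y \<notin> e" for e y
    using isCont_edge_root[of y "a e" "b e"] ab[OF that(1)] that(2) by (simp add: r_def)
  have r0: "r e y \<noteq> 0" if "e \<in> ?E" "y \<noteq> a e" "y \<noteq> b e" for e y
    using that edge_root_square[of "a e" "b e" y] by (auto simp: r_def)
  have G0: "G y \<noteq> 0" if y: "y \<in> \<Omega>" "\<And>e. e \<in> ?E \<Longrightarrow> y \<noteq> a e \<and> y \<noteq> b e" for y
  proof -
    have "(G y)\<^sup>2 \<noteq> 0"
      unfolding G(2)[OF y(1)] using finE y(2) r0 by (simp add: r_def)
    then show ?thesis
      by simp
  qed
  have ends: "a e \<in> e" "b e \<in> e" if "e \<in> ?E" for e
    using ab[OF that] by (metis ends_in_segment)+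
  \<comment> \<open>On an open triangle \<open>s\<close> is continuous with square 1, and a
    continuous function with finitely many values on a connected set is constant.\<close>
  have sgn: "\<exists>c. (c = 1 \<or> c = - 1) \<and> (\<forall>y\<in>interior K. s y = c)" if K: "K \<in> \<T>" for K
  proof -
    have sub: "interior K \<subseteq> \<Omega>"
      by (rule interior_triangle_subset[OF T reg K])
    have off: "y \<notin> e" if "y \<in> interior K" "e \<in> ?E" for y e
      using interior_triangle_disjoint_edge[OF T K that(2)] that(1) by blast
    have nz: "G y \<noteq> 0" if "y \<in> interior K" for y
      using G0[of y] that sub off ends by blast
    have one: "s y = 1 \<or> s y = - 1" if y: "y \<in> interior K" for y
    proof -
      have "(s y)\<^sup>2 = 1"
        using G(2)[of y] nz[OF y] y sub
        by (auto simp: s_def r_def power_divide prod_power_distrib)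
      then show ?thesis
        by (simp add: power2_eq_1_iff)
    qed
    have "isCont s y" if y: "y \<in> interior K" for y
      unfolding s_def[abs_def] using y off nz sub contG contr
      by (intro continuous_intros) auto
    then have "continuous_on (interior K) s"
      by (simp add: continuous_at_imp_continuous_on)
    moreover have "connected (interior K)"
      using convex_simplex[OF triangulation_simplex[OF T K]] by (intro convex_connected convex_interior)
    moreover have "finite (s ` interior K)"
      by (rule finite_subset[of _ "{1, - 1}"]) (use one in auto)
    ultimately have "s constant_on interior K"
      by (intro continuous_finite_range_constant)
    then obtain c where c: "\<And>y. y \<in> interior K \<Longrightarrow> s y = c"
      by (auto simp: constant_on_def)
    show ?thesis
    proof (cases "interior K = {}")
      case False
      then have "c = 1 \<or> c = - 1"
        using one c by force
      then show ?thesis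
        using c by blast
    qed auto
  qed
  then obtain \<sigma> where \<sigma>: "\<And>K. K \<in> \<T> \<Longrightarrow> \<sigma> K = 1 \<or> \<sigma> K = - 1"
    "\<And>K y. K \<in> \<T> \<Longrightarrow> y \<in> interior K \<Longrightarrow> s y = \<sigma> K"
    by metis
  define A where "A = {K \<in> \<T>. \<sigma> K = 1}"
  have flip: "K \<in> A \<longleftrightarrow> L \<notin> A" if KL: "K \<in> \<T>" "L \<in> \<T>" "K \<noteq> L" and e: "e edge_of K" "e edge_of L" for K L e
  proof (rule ccontr)
    assume same: "\<not> (K \<in> A \<longleftrightarrow> L \<notin> A)"
    have eE: "e \<in> ?E"
      using KL(1) e(1) by (auto simp: triangulation_edges_def)
    define c where "c = \<sigma> K"
    have "\<sigma> L = c" "c \<noteq> 0"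
      using same \<sigma>(1)[OF KL(1)] \<sigma>(1)[OF KL(2)] KL(1,2) by (auto simp: A_def c_def)
    then have c: "\<And>y. y \<in> interior K \<Longrightarrow> s y = c" "\<And>y. y \<in> interior L \<Longrightarrow> s y = c" "c \<noteq> 0"
      using \<sigma>(2) KL(1,2) by (auto simp: c_def)
    define u v where "u = a e" and "v = b e"
    have uv: "e = closed_segment u v" "u \<noteq> v"
      using ab[OF eE] by (auto simp: u_def v_def)
    define m where "m = midpoint u v"
    have m: "m \<in> open_segment u v"
      using uv(2) by (simp add: m_def)
    note e' = e[unfolded uv(1)]
    have "m \<in> \<Omega>"
      by (rule shared_edge_point_in_domain[OF T reg KL e' m])
    \<comment> \<open>No other edge passes through the midpoint of \<open>e\<close>, so all other
      edge roots are continuous at \<open>m\<close> and only the root of \<open>e\<close> changes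
      sign there.\<close>
    have m_off: "m \<notin> e'" if f: "e' \<in> ?E" "e' \<noteq> e" for e'
    proof
      assume "m \<in> e'"
      obtain M where M: "M \<in> \<T>" "e' edge_of M"
        using f(1) by (auto simp: triangulation_edges_def)
      then have "m \<in> M"
        using \<open>m \<in> e'\<close> edge_of_imp_subset by blast
      then have "e edge_of M"
        using edge_of_triangle_through_edge_point[OF T KL(1) M(1) e'(1) m] uv(1) by simp
      then show False
        using edges_meeting_in_open_segment[of u v M e' m] M(2) m \<open>m \<in> e'\<close> uv(1) f(2) by simp
    qed
    have "G m \<noteq> 0"
    proof (rule G0[OF \<open>m \<in> \<Omega>\<close>])
      fix e' assume "e' \<in> ?E"
      then show "m \<noteq> a e' \<and> m \<noteq> b e'"
        using m_off[of e'] ends[of e'] m by (cases "e' = e") (auto simp: u_def v_def open_segment_def)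
    qed
    define R where "R y = (\<Prod>e'\<in>?E - {e}. r e' y) / G y" for y
    define p where "p t = m + t *\<^sub>R perp (v - u)" for t
    \<comment> \<open>\<open>H\<close> is \<open>s\<close> along the normal at \<open>m\<close> with
      the factor \<open>sgn t\<close> removed; in contrast to \<open>s\<close> it is continuous at
      \<open>t = 0\<close>.\<close>
    define H where "H t = (\<i> * (cpx (v - u) / 2) * sqrt (1 + (2 * t)\<^sup>2)) * R (p t)" for t :: real
    have s_p: "s (p t) = sgn t *\<^sub>R H t" if "t \<noteq> 0" for t
    proof -
      have "s (p t) = r e (p t) * R (p t)"
        by (simp add: s_def R_def prod.remove[OF finE eE])
      then show ?thesis
        using edge_root_normal[OF uv(2) that] by (simp add: r_def u_def v_def m_def p_def H_def)
    qed
    have "isCont R m"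
      unfolding R_def[abs_def] using contG[OF \<open>m \<in> \<Omega>\<close>] \<open>G m \<noteq> 0\<close> m_off contr
      by (intro continuous_intros) auto
    then have "isCont R (p 0)"
      by (simp add: p_def)
    moreover have "isCont p 0"
      unfolding p_def[abs_def] by (intro continuous_intros)
    ultimately have "isCont (\<lambda>t. R (p t)) 0"
      by (rule isCont_o2[rotated])
    then have contH: "isCont H 0"
      unfolding H_def[abs_def] by (intro continuous_intros) auto
    note E = edge_of_triangleE[OF triangulation_simplex[OF T]]
    obtain w where K: "K = convex hull {u, v, w}" "cross2 (v - u) (w - u) \<noteq> 0"
      using E[OF KL(1) e'(1)] by blast
    obtain w' where L: "L = convex hull {u, v, w'}" "cross2 (v - u) (w' - u) \<noteq> 0"
      using E[OF KL(2) e'(2)] by blast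
    have opp: "cross2 (v - u) (w - u) * cross2 (v - u) (w' - u) < 0"
      by (rule triangles_on_opposite_sides[OF T KL e' K L])
    have "\<forall>\<^sub>F t in nhds 0. t \<noteq> 0 \<longrightarrow> p t \<in> interior K \<union> interior L"
      using eventually_normal_in_triangle_interior[OF K(2) m]
        eventually_normal_in_triangle_interior[OF L(2) m]
    proof eventually_elim
      case (elim t)
      have "t \<noteq> 0 \<Longrightarrow> 0 < t * cross2 (v - u) (w - u) \<or> 0 < t * cross2 (v - u) (w' - u)"
        using opp by (auto simp: zero_less_mult_iff mult_less_0_iff)
      then show ?case
        using elim K(1) L(1) unfolding p_def by blast
    qed
    \<comment> \<open>If both triangles had the same sign \<open>c\<close>, then \<open>H\<close>
      would be \<open>c\<close> to the right of 0 and \<open>- c\<close> to the left, which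
      continuity forbids as \<open>c\<close> is not 0.\<close>
    then have "\<forall>\<^sub>F t in at 0. sgn t *\<^sub>R H t = c"
      unfolding eventually_at_filter by eventually_elim (use c s_p in fastforce)
    then have "\<forall>\<^sub>F t in at_right 0. sgn t *\<^sub>R H t = c" and left: "\<forall>\<^sub>F t in at_left 0. sgn t *\<^sub>R H t = c"
      by (simp_all add: eventually_at_split)
    from this(1) eventually_at_right_less[of "0::real"] have "\<forall>\<^sub>F t in at_right 0. H t = c"
      by eventually_elim simp
    moreover have "\<forall>\<^sub>F t in at_left (0::real). t < 0"
      by (simp add: eventually_at_filter)
    with left have "\<forall>\<^sub>F t in at_left 0. H t = - c"
      by eventually_elim (simp add: minus_equation_iff)
    ultimately show False
      using sign_change_imp_zero[OF contH] c(3) by blast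
  qed
  show ?thesis
    unfolding bipartite_triangulation_def bipartite_graph_def
  proof (intro exI conjI)
    show "A \<union> (\<T> - A) = \<T>" "A \<inter> (\<T> - A) = {}"
      by (auto simp: A_def)
    show "\<forall>(K, L)\<in>triangle_arcs \<T>. K \<in> A \<and> L \<in> \<T> - A \<or> K \<in> \<T> - A \<and> L \<in> A"
      unfolding triangle_arcs_def using flip by blast
  qed
qed

theorem theorem2p9:
  fixes \<Omega> :: "(real^2) set" and \<T> :: "(real^2) set set"
  assumes "polygonal_domain \<Omega>"
    and "simply_connected \<Omega>"
    and "triangulation_of \<T> \<Omega>"
  shows "bipartite_triangulation \<T> \<longleftrightarrow>
    (\<forall>\<xi>\<in>interior_vertices \<T> \<Omega>. even (card {K \<in> \<T>. \<xi> \<in> frontier K}))"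
proof -
  have "open \<Omega>" "interior (closure \<Omega>) = \<Omega>"
    using assms(1) by (auto simp: polygonal_domain_def)
  then show ?thesis
    using bipartite_imp_even[OF assms(3)] even_imp_bipartite[OF assms(3,2)] by blast
qed

end
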